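(* Let $a\le m$ be positive integers and let $M_1,\ldots,M_m$ be matchings in a bipartite graph, ordered so that $|M_1|\le |M_2|\le\cdots\le |M_m|$. Suppose that $$\sum_{i=1}^{m-a+1}\bigl(|M_i|-a+1\bigr)\ \ge\ a .$$ Then there exists a rainbow matching of size $a$ for $(M_1,\ldots,M_m)$.
   Context: A rainbow matching for a family $(M_1,\ldots,M_m)$ of matchings is a matching $R$ (a set of pairwise disjoint edges) together with an injective map $\phi:R\to\{1,\ldots,m\}$ such that $e\in M_{\phi(e)}$ for every $e\in R$. Its size is $|R|$. *)

theory Defs
  imports Main
begin

(* An undirected simple graph is given by its vertex set V and its edge set E;
   an edge is the two-element set of its end vertices. *)
definition simple_graph :: "'v set \<Rightarrow> 'v set set \<Rightarrow> bool" where
  "simple_graph V E \<longleftrightarrow> (\<forall>e\<in>E. e \<subseteq> V \<and> card e = 2)"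

definition bipartite_graph :: "'v set \<Rightarrow> 'v set set \<Rightarrow> bool" where
  "bipartite_graph V E \<longleftrightarrow> simple_graph V E \<and>
     (\<exists>A B. A \<union> B = V \<and> A \<inter> B = {} \<and> (\<forall>e\<in>E. \<exists>x\<in>A. \<exists>y\<in>B. e = {x, y}))"

definition matching :: "'v set set \<Rightarrow> 'v set set \<Rightarrow> bool" where
  "matching E M \<longleftrightarrow> M \<subseteq> E \<and> pairwise disjnt M"

definition rainbow_matching ::
  "'v set set \<Rightarrow> nat \<Rightarrow> (nat \<Rightarrow> 'v set set) \<Rightarrow> 'v set set \<Rightarrow> ('v set \<Rightarrow> nat) \<Rightarrow> bool" where
  "rainbow_matching E m M R \<phi> \<longleftrightarrow>
     matching E R \<and> \<phi> ` R \<subseteq> {1..m} \<and> inj_on \<phi> R \<and> (\<forall>e\<in>R. e \<in> M (\<phi> e))"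

end

(* A rainbow matching of size k < a is enlarged by an alternating search that uses one new colour
   per round. Let S be the set of edges of T that have been reached. The matching of the new colour
   has at least |M_i| - (k - |S|) edges starting at vertices that are free or freed by S. If one of
   them ends at an uncovered vertex, T can be augmented; otherwise they end at as many distinct
   edges of T, and |S| grows by |M_i| - k. As |S| cannot exceed k, the m - a + 1 unused colours
   suffice. Every freed vertex carries its own exchanged rainbow matching, which still contains the
   unreached edges of T; this takes the place of alternating paths. *)

theory Submission imports Defs begin

section \<open>Coloured edges in a fixed bipartition\<close>

text \<open>A set of coloured edges \<open>(x, y, c)\<close>, with \<open>x\<close> and \<open>y\<close> on the two sides of the bipartition.\<close>

definition rainbow_set ::
  "('c \<Rightarrow> ('a \<times> 'b) set) \<Rightarrow> 'c set \<Rightarrow> ('a \<times> 'b \<times> 'c) set \<Rightarrow> bool" where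
  "rainbow_set N C T \<longleftrightarrow> (\<forall>(x, y, c) \<in> T. c \<in> C \<and> (x, y) \<in> N c) \<and>
     inj_on fst T \<and> inj_on (fst \<circ> snd) T \<and> inj_on (snd \<circ> snd) T"

lemma rainbow_set_mono:
  "rainbow_set N C T \<Longrightarrow> C \<subseteq> C' \<Longrightarrow> rainbow_set N C' T"
  unfolding rainbow_set_def by fast

lemma rainbow_set_subset:
  "rainbow_set N C T \<Longrightarrow> T' \<subseteq> T \<Longrightarrow> rainbow_set N C T'"
  unfolding rainbow_set_def by (meson inj_on_subset subset_iff)

lemma rainbow_set_insert:
  assumes "rainbow_set N C T" "d \<notin> C" "(x, y) \<in> N d"
    and "x \<notin> fst ` T" "y \<notin> (fst \<circ> snd) ` T"
  shows "rainbow_set N (insert d C) (insert (x, y, d) T)"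
proof -
  have "d \<notin> (snd \<circ> snd) ` T"
    using assms(1,2) by (auto simp: rainbow_set_def)
  moreover have "(x, y, d) \<notin> T"
    using assms(4) by force
  ultimately show ?thesis
    using assms by (auto simp: rainbow_set_def)
qed

section \<open>Alternating search and augmentation\<close>

text \<open>In the second alternative, \<open>x \<notin> fst ` (T - S)\<close> says that \<open>x\<close> is uncovered by \<open>T\<close> or is
  covered by an edge in \<open>S\<close>.\<close>

lemma alternating_search:
  assumes T: "rainbow_set N C T" "finite T"
    and "finite D" "C \<inter> D = {}"
    and N: "\<forall>d\<in>D. finite (N d) \<and> inj_on fst (N d) \<and> inj_on snd (N d)"
  shows "(\<exists>T'. rainbow_set N (C \<union> D) T' \<and> finite T' \<and> card T' = Suc (card T)) \<or>
    (\<exists>S\<subseteq>T. (\<Sum>d\<in>D. int (card (N d)) - int (card T)) \<le> int (card S) \<and>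
      (\<forall>x. x \<notin> fst ` (T - S) \<longrightarrow>
        (\<exists>T'. rainbow_set N (C \<union> D) T' \<and> finite T' \<and> card T' = card T \<and>
          (fst \<circ> snd) ` T' = (fst \<circ> snd) ` T \<and> x \<notin> fst ` T' \<and> T - S \<subseteq> T')))"
    (is "?augmented D \<or> (\<exists>S\<subseteq>T. ?reached D S)")
  using assms(3,4) N
proof (induction D rule: finite_induct)
  case empty
  \<comment> \<open>Nothing is reached yet, so \<open>x\<close> is uncovered by \<open>T\<close>,
    and \<open>T\<close> itself serves as \<open>T'\<close>.\<close>
  show ?case
    by (rule disjI2, rule exI[of _ "{}"]) (use T in auto)
next
  case (insert d D)
  let ?Y = "(fst \<circ> snd) ` T"
  have D: "d \<notin> C \<union> D" "C \<union> insert d D = insert d (C \<union> D)"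
    using insert by auto
  have Nd: "finite (N d)" "inj_on fst (N d)" "inj_on snd (N d)"
    using insert.prems(2) by auto
  consider "?augmented D" | S where "S \<subseteq> T" "?reached D S"
    using insert by auto
  then show ?case
  proof cases
    case 1
    then show ?thesis
      using rainbow_set_mono[of N "C \<union> D" _ "C \<union> insert d D"] by blast
  next
    case 2
    have freed: "\<exists>T'. rainbow_set N (C \<union> D) T' \<and> finite T' \<and> card T' = card T \<and>
          (fst \<circ> snd) ` T' = ?Y \<and> x \<notin> fst ` T' \<and> T - S \<subseteq> T'" if "x \<notin> fst ` (T - S)" for x
      by (rule 2(2)[THEN conjunct2, THEN spec, THEN mp, OF that])
    define P where "P = {p \<in> N d. fst p \<notin> fst ` (T - S)}"
    have "finite S"
      using 2(1) T(2) finite_subset by blast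
    show ?thesis
    proof (cases "snd ` P \<subseteq> ?Y")
      case False
      then obtain p where "p \<in> P" "snd p \<notin> ?Y"
        by blast
      then obtain x y where xy: "(x, y) \<in> N d" "x \<notin> fst ` (T - S)" "y \<notin> ?Y"
        using that[of "fst p" "snd p"] by (simp add: P_def)
      \<comment> \<open>\<open>T'\<close> covers the same second-side vertices as \<open>T\<close>,
        so \<open>y\<close> is uncovered there too. As \<open>d\<close> is a new colour,
        \<open>(x, y, d)\<close> can be added.\<close>
      obtain T' where T': "rainbow_set N (C \<union> D) T'" "finite T'"
        "card T' = card T" "(fst \<circ> snd) ` T' = ?Y" "x \<notin> fst ` T'"
        using freed[OF xy(2)] by auto
      have "rainbow_set N (C \<union> insert d D) (insert (x, y, d) T')"
        using rainbow_set_insert[OF T'(1) D(1) xy(1) T'(5)] xy(3) T'(4) D(2) by metis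
      moreover have "(x, y, d) \<notin> T'"
        using T'(5) by force
      ultimately show ?thesis
        using T'(2,3) by (metis card_insert_disjoint finite_insert)
    next
      case True
      \<comment> \<open>The newly reached edges are those that \<open>P\<close> hits at their second
        ends.\<close>
      define S' where "S' = S \<union> {t \<in> T. fst (snd t) \<in> snd ` P}"
      have "S \<subseteq> S'"
        by (simp add: S'_def)
      have "S' \<subseteq> T"
        using 2(1) by (auto simp: S'_def)
      have "finite S'"
        using \<open>S' \<subseteq> T\<close> T(2) finite_subset by blast
      \<comment> \<open>Edges of \<open>N d\<close> outside \<open>P\<close> start at distinct
        vertices covered by \<open>T - S\<close>.\<close>
      have "card (N d) \<le> card P + card (T - S)"
      proof -
        have "finite P"
          using Nd(1) by (simp add: P_def)
        have "card (N d - P) \<le> card (fst ` (T - S))"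
          by (rule card_inj_on_le[of fst])
            (use Nd T(2) in \<open>auto simp: P_def intro: inj_on_subset\<close>)
        also have "\<dots> \<le> card (T - S)"
          using T(2) by (simp add: card_image_le)
        finally show ?thesis
          using card_Diff_subset[OF \<open>finite P\<close>, of "N d"] by (auto simp: P_def)
      qed
      moreover have "card (T - S) + card S = card T"
        using 2(1) T(2) by (simp add: card_Diff_subset card_mono \<open>finite S\<close>)
      \<comment> \<open>The second ends of \<open>P\<close> are distinct, and each lies on an edge
        of \<open>S'\<close>.\<close>
      moreover have "card P \<le> card S'"
      proof -
        have "card P = card (snd ` P)"
          by (rule card_image[symmetric], rule inj_on_subset[OF Nd(3)]) (auto simp: P_def)
        also have "\<dots> \<le> card ((fst \<circ> snd) ` S')"
        proof (rule card_mono)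
          show "snd ` P \<subseteq> (fst \<circ> snd) ` S'"
          proof
            fix y assume "y \<in> snd ` P"
            moreover from this obtain t where "t \<in> T" "y = (fst \<circ> snd) t"
              using True by blast
            ultimately show "y \<in> (fst \<circ> snd) ` S'"
              by (intro image_eqI[of _ _ t]) (simp_all add: S'_def)
          qed
        qed (use \<open>finite S'\<close> in simp)
        also have "\<dots> \<le> card S'"
          using \<open>finite S'\<close> by (rule card_image_le)
        finally show ?thesis .
      qed
      \<comment> \<open>Altogether
        \<open>card S' \<ge> card P \<ge> card (N d) - card T + card S\<close>, and the induction
        hypothesis bounds \<open>card S\<close> from below.\<close>
      ultimately have "(\<Sum>d\<in>insert d D. int (card (N d)) - int (card T)) \<le> int (card S')"
        using 2(2)[THEN conjunct1] insert.hyps by simp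
      moreover have "\<exists>T'. rainbow_set N (C \<union> insert d D) T' \<and> finite T' \<and> card T' = card T \<and>
          (fst \<circ> snd) ` T' = ?Y \<and> x' \<notin> fst ` T' \<and> T - S' \<subseteq> T'"
        if x': "x' \<notin> fst ` (T - S')" for x'
      proof (cases "x' \<in> fst ` (T - S)")
        \<comment> \<open>Here \<open>x'\<close> was free or freed before this round, and its old
          witness still serves.\<close>
        case False
        have "T - S' \<subseteq> T - S" "C \<union> D \<subseteq> C \<union> insert d D"
          by (auto simp: S'_def)
        then show ?thesis
          using freed[OF False] by (meson rainbow_set_mono subset_trans)
      next
        case True
        \<comment> \<open>Here \<open>x'\<close> is freed by exchanging \<open>(x', y, c)\<close>
          for some \<open>(x, y, d)\<close>. The exchange takes place in the witness
          \<open>T'\<close> of \<open>x\<close>, which still contains \<open>(x', y, c)\<close>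
          because this edge lies in \<open>T - S\<close>.\<close>
        then obtain y c where t: "(x', y, c) \<in> T - S"
          by force
        with x' have "(x', y, c) \<in> S'"
          by force
        with t obtain x where xy: "(x, y) \<in> N d" "x \<notin> fst ` (T - S)"
          by (auto simp: S'_def P_def)
        obtain T' where T': "rainbow_set N (C \<union> D) T'" "finite T'"
          "card T' = card T" "(fst \<circ> snd) ` T' = ?Y" "x \<notin> fst ` T'" "T - S \<subseteq> T'"
          using freed[OF xy(2)] by auto
        let ?T = "T' - {(x', y, c)}"
        have tT': "(x', y, c) \<in> T'"
          using t T'(6) by blast
        \<comment> \<open>By injectivity the removal uncovers exactly \<open>y\<close> and
          \<open>x'\<close>; the new edge then covers \<open>y\<close> again, but not
          \<open>x'\<close>.\<close>
        have y: "(fst \<circ> snd) ` ?T = ?Y - {y}"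
          using T'(1,4) tT' inj_on_image_set_diff[of "fst \<circ> snd" T' T' "{(x', y, c)}"]
          by (simp add: rainbow_set_def)
        have x: "fst ` ?T = fst ` T' - {x'}"
          using T'(1) tT' inj_on_image_set_diff[of fst T' T' "{(x', y, c)}"]
          by (simp add: rainbow_set_def)
        have "x \<noteq> x'"
          using T'(5) tT' by force
        have "(x, y, d) \<notin> ?T"
          using T'(5) by force
        have "rainbow_set N (insert d (C \<union> D)) (insert (x, y, d) ?T)"
          by (rule rainbow_set_insert[OF rainbow_set_subset[OF T'(1)] D(1) xy(1)])
            (use x y T'(5) in auto)
        moreover have "card (insert (x, y, d) ?T) = card T"
          using \<open>(x, y, d) \<notin> ?T\<close> tT' T'(2,3) by (metis card.remove card_insert_disjoint finite_Diff)
        moreover have "(fst \<circ> snd) ` insert (x, y, d) ?T = ?Y"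
          using y t by force
        moreover have "x' \<notin> fst ` insert (x, y, d) ?T"
          using x \<open>x \<noteq> x'\<close> by auto
        \<comment> \<open>The only edge given up belongs to \<open>S'\<close>.\<close>
        moreover have "T - S' \<subseteq> insert (x, y, d) ?T"
          using T'(6) \<open>(x', y, c) \<in> S'\<close> \<open>S \<subseteq> S'\<close> by blast
        ultimately show ?thesis
          using T'(2) D(2) by (metis finite_Diff finite_insert)
      qed
      ultimately show ?thesis
        using \<open>S' \<subseteq> T\<close> by blast
    qed
  qed
qed

text \<open>The search must end in an augmentation: the reached edges all lie in \<open>T\<close>,
  so there are at most \<open>card T\<close> of them.\<close>

lemma rainbow_set_augment:
  assumes "rainbow_set N C T" "finite T" "finite D" "C \<inter> D = {}"
    and "\<forall>d\<in>D. finite (N d) \<and> inj_on fst (N d) \<and> inj_on snd (N d)"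
    and "int (card T) < (\<Sum>d\<in>D. int (card (N d)) - int (card T))"
  obtains T' where "rainbow_set N (C \<union> D) T'" "finite T'" "card T' = Suc (card T)"
proof -
  from alternating_search[OF assms(1-5)] show thesis
  proof (elim disjE exE conjE)
    fix T' assume "rainbow_set N (C \<union> D) T'" "finite T'" "card T' = Suc (card T)"
    then show thesis
      by (rule that)
  next
    fix S assume "S \<subseteq> T" and S: "(\<Sum>d\<in>D. int (card (N d)) - int (card T)) \<le> int (card S)"
    have "card S \<le> card T"
      using assms(2) \<open>S \<subseteq> T\<close> by (rule card_mono)
    with S assms(6) show thesis
      by linarith
  qed
qed

lemma sum_initial_segment_le:
  fixes f :: "nat \<Rightarrow> int"
  assumes "D \<subseteq> {1..m}" "card D = n"
    and mono: "\<And>i j. 1 \<le> i \<Longrightarrow> i \<le> j \<Longrightarrow> j \<le> m \<Longrightarrow> f i \<le> f j"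
  shows "sum f {1..n} \<le> sum f D"
  using assms(1,2)
proof (induction n arbitrary: D)
  case 0
  then show ?case
    by (metis atLeastatMost_empty_iff2 card_eq_0_iff finite_atLeastAtMost finite_subset
        not_one_le_zero order_refl)
next
  case (Suc n)
  have "finite D" "D \<noteq> {}"
    using Suc.prems finite_subset by auto
  define j where "j = Max D"
  have j: "j \<in> D" "D \<subseteq> {1..j}"
    using \<open>finite D\<close> \<open>D \<noteq> {}\<close> Suc.prems(1) by (auto simp: j_def)
  \<comment> \<open>The maximum of \<open>Suc n\<close> distinct positive indices is at least
    \<open>Suc n\<close>.\<close>
  have "Suc n \<le> j"
    using card_mono[OF _ j(2)] Suc.prems(2) by simp
  then have "f (Suc n) \<le> f j"
    using j Suc.prems(1) by (intro mono) auto
  moreover have "sum f {1..n} \<le> sum f (D - {j})"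
    using Suc.prems j(1) by (intro Suc.IH) auto
  ultimately show ?case
    using sum.remove[OF \<open>finite D\<close> j(1), of f] by simp
qed

lemma rainbow_set_exists:
  fixes N :: "nat \<Rightarrow> ('a \<times> 'b) set"
  assumes "1 \<le> a" "a \<le> m"
    and N: "\<And>i. i \<in> {1..m} \<Longrightarrow> finite (N i) \<and> inj_on fst (N i) \<and> inj_on snd (N i)"
    and mono: "\<And>i j. 1 \<le> i \<Longrightarrow> i \<le> j \<Longrightarrow> j \<le> m \<Longrightarrow> card (N i) \<le> card (N j)"
    and sum: "int a \<le> (\<Sum>i = 1..m - a + 1. int (card (N i)) - int a + 1)"
    and "k \<le> a"
  shows "\<exists>T. rainbow_set N {1..m} T \<and> finite T \<and> card T = k"
  using \<open>k \<le> a\<close>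
proof (induction k)
  case 0
  show ?case
    by (rule exI[of _ "{}"]) (simp add: rainbow_set_def)
next
  case (Suc k)
  then obtain T where T: "rainbow_set N {1..m} T" "finite T" "card T = k"
    by auto
  \<comment> \<open>Restricting the palette to the colours in use makes all others new for the
    search.\<close>
  define C where "C = (snd \<circ> snd) ` T"
  have C: "C \<subseteq> {1..m}" "rainbow_set N C T"
    using T(1) by (force simp: rainbow_set_def C_def)+
  have "card C = k"
    using T(1,3) card_image[of "snd \<circ> snd" T] by (simp add: rainbow_set_def C_def)
  have "card ({1..m} - C) = m - k"
    using C(1) \<open>card C = k\<close> by (simp add: card_Diff_subset finite_subset[OF C(1)])
  then have "m - a + 1 \<le> card ({1..m} - C)"
    using Suc.prems assms(2) by simp
  then obtain D where D: "D \<subseteq> {1..m} - C" "card D = m - a + 1"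
    by (meson obtain_subset_with_card_n)
  have "finite D"
    using D(1) finite_subset by blast
  \<comment> \<open>This enters twice: as the strict step of the chain, and as
    \<open>k \<le> a - 1\<close>, which compares the summands \<open>card (N d) - a + 1\<close> and
    \<open>card (N d) - k\<close>.\<close>
  have "int k < int a"
    using Suc.prems by simp
  also have "\<dots> \<le> (\<Sum>d\<in>D. int (card (N d)) - int a + 1)"
    by (rule order_trans[OF sum], rule sum_initial_segment_le) (use D mono in auto)
  also have "\<dots> \<le> (\<Sum>d\<in>D. int (card (N d)) - int (card T))"
    using Suc.prems T(3) by (intro sum_mono) auto
  finally have "int (card T) < (\<Sum>d\<in>D. int (card (N d)) - int (card T))"
    using T(3) by simp
  moreover have "C \<inter> D = {}" "\<forall>d\<in>D. finite (N d) \<and> inj_on fst (N d) \<and> inj_on snd (N d)"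
    using D(1) N by blast+
  ultimately obtain T' where "rainbow_set N (C \<union> D) T'" "finite T'" "card T' = Suc (card T)"
    using rainbow_set_augment[OF C(2) T(2) \<open>finite D\<close>] by metis
  moreover have "C \<union> D \<subseteq> {1..m}"
    using C(1) D(1) by blast
  ultimately show ?case
    using T(3) rainbow_set_mono by blast
qed

section \<open>Translation to two-element edges\<close>

theorem theorem1p6:
  fixes V :: "'v set" and E :: "'v set set" and M :: "nat \<Rightarrow> 'v set set" and a m :: nat
  assumes "bipartite_graph V E"
    and "1 \<le> a" and "a \<le> m"
    and "\<And>i. i \<in> {1..m} \<Longrightarrow> matching E (M i) \<and> finite (M i)"
    and "\<And>i j. 1 \<le> i \<Longrightarrow> i \<le> j \<Longrightarrow> j \<le> m \<Longrightarrow> card (M i) \<le> card (M j)"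
    and "(\<Sum>i = 1..m - a + 1. int (card (M i)) - int a + 1) \<ge> int a"
  shows "\<exists>R \<phi>. rainbow_matching E m M R \<phi> \<and> card R = a"
proof -
  obtain A B where AB: "A \<inter> B = {}" "\<And>e. e \<in> E \<Longrightarrow> \<exists>x\<in>A. \<exists>y\<in>B. e = {x, y}"
    using assms(1) unfolding bipartite_graph_def by auto
  define edge :: "'v \<times> 'v \<Rightarrow> 'v set" where "edge = (\<lambda>(x, y). {x, y})"
  \<comment> \<open>Since \<open>A\<close> and \<open>B\<close> are disjoint, an edge determines
    which of its ends comes first.\<close>
  have inj: "inj_on edge (A \<times> B)"
    using AB(1) by (auto simp: inj_on_def edge_def doubleton_eq_iff)
  define N where "N i = {p \<in> A \<times> B. edge p \<in> M i}" for i
  have N: "bij_betw edge (N i) (M i)" if "i \<in> {1..m}" for i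
  proof -
    have "M i \<subseteq> E"
      using assms(4)[OF that] by (simp add: matching_def)
    then have "edge ` N i = M i"
      using AB(2) by (fastforce simp: N_def edge_def image_iff)
    moreover have "inj_on edge (N i)"
      by (rule inj_on_subset[OF inj]) (auto simp: N_def)
    ultimately show ?thesis
      by (simp add: bij_betw_def)
  qed
  have card: "card (N i) = card (M i)" if "i \<in> {1..m}" for i
    using N[OF that] bij_betw_same_card by blast
  have "\<exists>T. rainbow_set N {1..m} T \<and> finite T \<and> card T = a"
  proof (rule rainbow_set_exists[OF assms(2,3) _ _ _ order_refl])
    fix i assume i: "i \<in> {1..m}"
    have disj: "e = e'" if "e \<in> M i" "e' \<in> M i" "v \<in> e" "v \<in> e'" for e e' v
      using assms(4)[OF i] that unfolding matching_def pairwise_def disjnt_def by blast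
    have "p = q" if "p \<in> N i" "q \<in> N i" "edge p = edge q" for p q
      using N[OF i] that by (meson bij_betw_def inj_onD)
    moreover have "edge p = edge q" if "p \<in> N i" "q \<in> N i" "fst p = fst q \<or> snd p = snd q" for p q
      using that by (intro disj[where v = "if fst p = fst q then fst p else snd p"])
        (auto simp: N_def edge_def)
    ultimately have "p = q" if "p \<in> N i" "q \<in> N i" "fst p = fst q \<or> snd p = snd q" for p q
      using that by blast
    then have "inj_on fst (N i)" "inj_on snd (N i)"
      by (blast intro: inj_onI)+
    then show "finite (N i) \<and> inj_on fst (N i) \<and> inj_on snd (N i)"
      using N[OF i] assms(4)[OF i] bij_betw_finite by blast
  next
    show "card (N i) \<le> card (N j)" if "1 \<le> i" "i \<le> j" "j \<le> m" for i j
      using assms(5)[OF that] that card by auto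
  next
    have "(\<Sum>i = 1..m - a + 1. int (card (N i)) - int a + 1) =
        (\<Sum>i = 1..m - a + 1. int (card (M i)) - int a + 1)"
      using assms(2,3) by (intro sum.cong) (auto simp: card)
    then show "int a \<le> (\<Sum>i = 1..m - a + 1. int (card (N i)) - int a + 1)"
      using assms(6) by simp
  qed
  then obtain T where T: "rainbow_set N {1..m} T" "finite T" "card T = a"
    by blast
  define edge3 :: "'v \<times> 'v \<times> nat \<Rightarrow> 'v set" where "edge3 = (\<lambda>(x, y, c). {x, y})"
  have mem: "x \<in> A" "y \<in> B" "c \<in> {1..m}" "{x, y} \<in> M c" if "(x, y, c) \<in> T" for x y c
    using T(1) that by (auto simp: rainbow_set_def N_def edge_def)
  have disj: "t = t'" if "t \<in> T" "t' \<in> T" "edge3 t \<inter> edge3 t' \<noteq> {}" for t t'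
  proof -
    obtain x y c x' y' c' where t: "t = (x, y, c)" "t' = (x', y', c')"
      using prod_cases3 by metis
    \<comment> \<open>First ends lie in \<open>A\<close> and second ends in \<open>B\<close>, so two
      edges can meet only on the same side, where injectivity on \<open>T\<close> applies.\<close>
    have "x \<noteq> y'" "y \<noteq> x'"
      using mem that(1,2) AB(1) unfolding t by blast+
    then have "fst t = fst t' \<or> (fst \<circ> snd) t = (fst \<circ> snd) t'"
      using that(3) by (auto simp: t edge3_def)
    then show ?thesis
      using T(1) that(1,2) unfolding rainbow_set_def by (meson inj_onD)
  qed
  have inj3: "inj_on edge3 T"
  proof (rule inj_onI)
    fix t t' assume "t \<in> T" "t' \<in> T" "edge3 t = edge3 t'"
    \<comment> \<open>Equal nonempty edges intersect, so \<open>disj\<close> applies.\<close>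
    moreover have "edge3 t' \<noteq> {}"
      by (cases t') (simp add: edge3_def)
    ultimately show "t = t'"
      by (intro disj) simp_all
  qed
  \<comment> \<open>The colour of an edge is read off its unique preimage in
    \<open>T\<close>.\<close>
  define \<phi> where "\<phi> = snd \<circ> snd \<circ> inv_into T edge3"
  have \<phi>: "\<phi> (edge3 t) = snd (snd t)" if "t \<in> T" for t
    using inj3 that by (simp add: \<phi>_def)
  have colour: "edge3 t \<in> M (snd (snd t))" "snd (snd t) \<in> {1..m}" if "t \<in> T" for t
    using mem that by (cases t; simp add: edge3_def)+
  have "edge3 ` T \<subseteq> E"
    using colour assms(4) unfolding matching_def by blast
  moreover have "pairwise disjnt (edge3 ` T)"
    unfolding pairwise_image pairwise_def disjnt_def using disj by blast
  moreover have "inj_on \<phi> (edge3 ` T)"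
  proof (rule inj_on_imageI)
    have "inj_on (snd \<circ> snd) T"
      using T(1) by (simp add: rainbow_set_def)
    then show "inj_on (\<phi> \<circ> edge3) T"
      using \<phi> by (subst inj_on_cong[where g = "snd \<circ> snd"]) simp_all
  qed
  moreover have "\<phi> ` edge3 ` T \<subseteq> {1..m}" "\<forall>e \<in> edge3 ` T. e \<in> M (\<phi> e)"
    using colour \<phi> by auto
  ultimately have "rainbow_matching E m M (edge3 ` T) \<phi>"
    by (simp add: rainbow_matching_def matching_def)
  moreover have "card (edge3 ` T) = a"
    using inj3 T(3) by (simp add: card_image)
  ultimately show ?thesis
    by blast
qed

end
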